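(* Let $1\le p\le\infty$, let $W$ be an $L^p$ graphon, and let $(G_n)_{n\ge0}$ be a sequence of weighted graphs with no dominant nodes and with $\delta_\square(G_n/\|G_n\|_1,W)\to0$ as $n\to\infty$. Then $(G_n)_{n\ge0}$ is a $\|W\|_p$-upper $L^p$ regular sequence.
   Context: A weighted graph $G$ is a finite graph with vertex set $V(G)$, in which each vertex $i$ has a weight $\alpha_i=\alpha_i(G)>0$ and each edge $ij$ (loops $i=j$ allowed) has a weight $\beta_{ij}=\beta_{ji}\in\mathbb{R}$, with $\beta_{ij}=0$ if $ij$ is not an edge. For $U\subseteq V(G)$ put $\alpha_U=\sum_{i\in U}\alpha_i$, and $\alpha_G=\alpha_{V(G)}$. Put $\|G\|_1=\sum_{i,j\in V(G)}\frac{\alpha_i\alpha_j}{\alpha_G^2}|\beta_{ij}|$; graphs being normalized are assumed to have $\|G\|_1\neq0$. For $c\in\mathbb{R}$, $cG$ is $G$ with all edge weights multiplied by $c$. A sequence $(G_n)$ has no dominant nodes if $\lim_{n\to\infty}\max_{i\in V(G_n)}\alpha_i(G_n)/\alpha_{G_n}=0$. For nonempty $S,T\subseteq V(G)$ let $\rho_G(S,T)=\sum_{s\in S,\,t\in T}\frac{\alpha_s\alpha_t}{\alpha_S\alpha_T}\beta_{st}$. The graph $G$ is $(C,\eta)$-upper $L^p$ regular if $\alpha_i\le\eta\alpha_G$ for all $i\in V(G)$ and, whenever $V_1\cup\dots\cup V_m$ is a partition of $V(G)$ into disjoint sets with $\alpha_{V_i}\ge\eta\alpha_G$ for each $i$,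 $$\sum_{i,j=1}^m\frac{\alpha_{V_i}\alpha_{V_j}}{\alpha_G^2}\left|\frac{\rho_G(V_i,V_j)}{\|G\|_1}\right|^p\le C^p,$$ where for $p=\infty$ this is replaced by $\max_{i,j}|\rho_G(V_i,V_j)|/\|G\|_1\le C$. For $C\ge0$ and $1\le p\le\infty$, a sequence $(G_n)_{n\ge0}$ is $C$-upper $L^p$ regular if for every $\eta>0$ there is $n_0(\eta)$ such that $G_n$ is $(C+\eta,\eta)$-upper $L^p$ regular for all $n\ge n_0(\eta)$. A graphon is a symmetric (Borel) measurable integrable function $W:[0,1]^2\to\mathbb{R}$; $\|W\|_p$ is the $L^p$ norm with respect to Lebesgue measure on $[0,1]^2$ (essential supremum of $|W|$ for $p=\infty$); an $L^p$ graphon is a graphon with $\|W\|_p<\infty$. The cut norm is $\|W\|_\square=\sup_{S,T\subseteq[0,1]\text{ measurable}}\left|\int_{S\times T}W\right|$, and $\delta_\square(W,W')=\inf_\sigma\|W^\sigma-W'\|_\square$ over measure-preserving bijections $\sigma:[0,1]\to[0,1]$, where $W^\sigma(x,y)=W(\sigma(x),\sigma(y))$. The graphon $W^G$ of a weighted graph $G$: divide $[0,1]$ into consecutive intervals $I_i$ of length $\alpha_i/\alpha_G$ ($i\in V(G)$) and let $W^G=\beta_{ij}$ on $I_i\times I_j$. Finally $\delta_\square(G,W):=\delta_\square(W^G,W)$. *)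

theory Defs
  imports "HOL-Probability.Essential_Supremum"
begin

section \<open>Weighted graphs\<close>

(* Edges are sets {i, j}; a loop at i is the singleton {i}. *)
record 'v wgraph =
  verts :: "'v set"
  edges :: "'v set set"
  vweight :: "'v \<Rightarrow> real"
  eweight :: "'v \<Rightarrow> 'v \<Rightarrow> real"

(* Weights are constrained on verts only; the values elsewhere are never used. *)
definition weighted_graph :: "'v wgraph \<Rightarrow> bool" where
  "weighted_graph G \<longleftrightarrow>
     finite (verts G) \<and>
     edges G \<subseteq> {{i, j} | i j. i \<in> verts G \<and> j \<in> verts G} \<and>
     (\<forall>i\<in>verts G. vweight G i > 0) \<and>
     (\<forall>i\<in>verts G. \<forall>j\<in>verts G. eweight G i j = eweight G j i) \<and>
     (\<forall>i\<in>verts G. \<forall>j\<in>verts G. {i, j} \<notin> edges G \<longrightarrow> eweight G i j = 0)"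

definition set_weight :: "'v wgraph \<Rightarrow> 'v set \<Rightarrow> real" where
  "set_weight G U = (\<Sum>i\<in>U. vweight G i)"

definition total_weight :: "'v wgraph \<Rightarrow> real" where
  "total_weight G = set_weight G (verts G)"

definition graph_norm1 :: "'v wgraph \<Rightarrow> real" where
  "graph_norm1 G =
     (\<Sum>i\<in>verts G. \<Sum>j\<in>verts G.
        vweight G i * vweight G j / (total_weight G)\<^sup>2 * \<bar>eweight G i j\<bar>)"

definition scale_graph :: "real \<Rightarrow> 'v wgraph \<Rightarrow> 'v wgraph" where
  "scale_graph c G = G\<lparr>eweight := (\<lambda>i j. c * eweight G i j)\<rparr>"

definition no_dominant_nodes :: "(nat \<Rightarrow> 'v wgraph) \<Rightarrow> bool" where
  "no_dominant_nodes G \<longleftrightarrow>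
     (\<lambda>n. MAX i\<in>verts (G n). vweight (G n) i / total_weight (G n)) \<longlonglongrightarrow> 0"

definition density :: "'v wgraph \<Rightarrow> 'v set \<Rightarrow> 'v set \<Rightarrow> real" where
  "density G S T =
     (\<Sum>s\<in>S. \<Sum>t\<in>T.
        vweight G s * vweight G t / (set_weight G S * set_weight G T) * eweight G s t)"

section \<open>Upper regularity\<close>

definition upper_Lp_regular :: "ennreal \<Rightarrow> real \<Rightarrow> real \<Rightarrow> 'v wgraph \<Rightarrow> bool" where
  "upper_Lp_regular p C \<eta> G \<longleftrightarrow>
     (\<forall>i\<in>verts G. vweight G i \<le> \<eta> * total_weight G) \<and>
     (\<forall>P. partition_on (verts G) P \<and> (\<forall>A\<in>P. set_weight G A \<ge> \<eta> * total_weight G) \<longrightarrow>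
        (if p = \<infinity>
         then (MAX (A, B)\<in>P \<times> P. \<bar>density G A B\<bar> / graph_norm1 G) \<le> C
         else (\<Sum>A\<in>P. \<Sum>B\<in>P.
                 set_weight G A * set_weight G B / (total_weight G)\<^sup>2 *
                 \<bar>density G A B / graph_norm1 G\<bar> powr enn2real p)
              \<le> C powr enn2real p))"

definition upper_Lp_regular_seq :: "ennreal \<Rightarrow> real \<Rightarrow> (nat \<Rightarrow> 'v wgraph) \<Rightarrow> bool" where
  "upper_Lp_regular_seq p C G \<longleftrightarrow>
     (\<forall>\<eta>>0. \<exists>n0. \<forall>n\<ge>n0. upper_Lp_regular p (C + \<eta>) \<eta> (G n))"

section \<open>Graphons\<close>

definition unit_interval :: "real measure" where
  "unit_interval = restrict_space lborel {0..1}"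

definition unit_square :: "(real \<times> real) measure" where
  "unit_square = restrict_space lborel ({0..1} \<times> {0..1})"

definition graphon :: "(real \<Rightarrow> real \<Rightarrow> real) \<Rightarrow> bool" where
  "graphon W \<longleftrightarrow>
     (\<forall>x\<in>{0..1}. \<forall>y\<in>{0..1}. W x y = W y x) \<and>
     integrable unit_square (\<lambda>(x, y). W x y)"

(* The branch for an infinite integral is needed because enn2real maps infinity to 0. *)
definition Lp_norm :: "ennreal \<Rightarrow> (real \<Rightarrow> real \<Rightarrow> real) \<Rightarrow> ennreal" where
  "Lp_norm p W =
     (if p = \<infinity> then esssup unit_square (\<lambda>(x, y). ennreal \<bar>W x y\<bar>)
      else let I = \<integral>\<^sup>+(x, y). ennreal (\<bar>W x y\<bar> powr enn2real p) \<partial>unit_square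
           in if I = \<infinity> then \<infinity> else ennreal (enn2real I powr (1 / enn2real p)))"

definition Lp_graphon :: "ennreal \<Rightarrow> (real \<Rightarrow> real \<Rightarrow> real) \<Rightarrow> bool" where
  "Lp_graphon p W \<longleftrightarrow> graphon W \<and> Lp_norm p W < \<infinity>"

definition cut_norm :: "(real \<Rightarrow> real \<Rightarrow> real) \<Rightarrow> real" where
  "cut_norm W =
     (SUP (S, T)\<in>sets unit_interval \<times> sets unit_interval.
        \<bar>LINT (x, y):S \<times> T|unit_square. W x y\<bar>)"

(* A Borel bijection of [0,1] has a Borel inverse, so this is not required separately. *)
definition measure_preserving_bij :: "(real \<Rightarrow> real) \<Rightarrow> bool" where
  "measure_preserving_bij \<sigma> \<longleftrightarrow>
     bij_betw \<sigma> {0..1} {0..1} \<and>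
     \<sigma> \<in> measurable unit_interval unit_interval \<and>
     distr unit_interval unit_interval \<sigma> = unit_interval"

definition rearrange :: "(real \<Rightarrow> real) \<Rightarrow> (real \<Rightarrow> real \<Rightarrow> real) \<Rightarrow> real \<Rightarrow> real \<Rightarrow> real" where
  "rearrange \<sigma> W x y = W (\<sigma> x) (\<sigma> y)"

definition cut_dist :: "(real \<Rightarrow> real \<Rightarrow> real) \<Rightarrow> (real \<Rightarrow> real \<Rightarrow> real) \<Rightarrow> real" where
  "cut_dist W W' =
     (INF \<sigma>\<in>{\<sigma>. measure_preserving_bij \<sigma>}. cut_norm (\<lambda>x y. rearrange \<sigma> W x y - W' x y))"

(* The intervals follow the linear order of the vertices; they are half-open except
   for the last one, so that they partition [0,1]. *)
definition node_interval :: "('v::linorder) wgraph \<Rightarrow> 'v \<Rightarrow> real set" where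
  "node_interval G i =
     (let a = set_weight G {j \<in> verts G. j < i} / total_weight G;
          b = set_weight G {j \<in> verts G. j \<le> i} / total_weight G
      in if i = Max (verts G) then {a..b} else {a..<b})"

definition graphon_of :: "('v::linorder) wgraph \<Rightarrow> real \<Rightarrow> real \<Rightarrow> real" where
  "graphon_of G x y =
     (\<Sum>i\<in>verts G. \<Sum>j\<in>verts G.
        eweight G i j * indicator (node_interval G i) x * indicator (node_interval G j) y)"

definition graph_cut_dist :: "('v::linorder) wgraph \<Rightarrow> (real \<Rightarrow> real \<Rightarrow> real) \<Rightarrow> real" where
  "graph_cut_dist G W = cut_dist (graphon_of G) W"

end

theory Submission
  imports Defs "HOL-Probability.Probability_Measure"
begin

text \<open>A partition of the nodes of \<open>G\<close> into parts of relative weight at least \<open>\<eta>\<close> becomes, after a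
  rearrangement of \<open>W\<^sup>G\<close> that is nearly optimal for the cut distance, a partition of \<open>[0,1]\<close> into
  sets of measure at least \<open>\<eta>\<close>. On each block of measure at least \<open>\<eta>\<^sup>2\<close> the integrals of the
  rearranged graphon and of \<open>W\<close> differ by at most the cut norm, so a cut distance below
  \<open>\<eta>\<^sup>2 * (\<eta> / 2)\<close> forces all block densities of \<open>G\<close> to be within \<open>\<eta> / 2\<close> of the block averages
  of \<open>W\<close>. By Jensen's inequality averaging does not increase the \<open>L\<^sup>p\<close> norm, and Minkowski's
  inequality absorbs the error.\<close>

section \<open>Convexity of powers\<close>

text \<open>Convexity puts the graph above its tangent at \<open>m\<close>. Convexity is used on the
  open half-line, so \<open>t = 0\<close> is treated by hand: there the claim says
  \<open>m powr r\<close> is at most \<open>r * m powr r\<close>, which is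
  \<open>1 \<le> r\<close>.\<close>

lemma powr_ge_tangent:
  fixes t m r :: real
  assumes "1 \<le> r" "0 \<le> t" "0 < m"
  shows "m powr r + r * m powr (r - 1) * (t - m) \<le> t powr r"
proof (cases "t = 0")
  case True
  have "m powr (r - 1) * m = m powr r"
    using \<open>0 < m\<close> by (simp add: powr_diff)
  moreover have "m powr r \<le> r * m powr r"
    using \<open>1 \<le> r\<close> mult_right_mono[of 1 r "m powr r"] by simp
  ultimately show ?thesis
    using True by (simp add: algebra_simps)
next
  case False
  have "((\<lambda>x. x powr r) has_real_derivative r * m powr (r - 1)) (at m within {0<..})"
    using \<open>0 < m\<close> by (auto intro!: derivative_eq_intros)
  then show ?thesis
    using convex_on_imp_above_tangent[OF powr_convex[OF \<open>1 \<le> r\<close>], of m t] assms False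
    by (fastforce simp: interior_open)
qed

text \<open>Jensen's inequality for the two points \<open>u\<close> and \<open>1\<close>: the
  tangent inequalities at the mean \<open>m\<close> are added with weights \<open>c\<close> and
  \<open>1 - c\<close>, and their linear terms cancel. The condition \<open>c < 1\<close> keeps
  \<open>m\<close> positive even when \<open>u = 0\<close>.\<close>

lemma powr_convex_combination:
  fixes u c r :: real
  assumes "1 \<le> r" "0 \<le> u" "0 \<le> c" "c < 1"
  shows "(c * u + (1 - c)) powr r \<le> c * u powr r + (1 - c)"
proof -
  define m where "m = c * u + (1 - c)"
  have "0 < m"
    unfolding m_def using assms by (intro add_nonneg_pos mult_nonneg_nonneg) auto
  let ?k = "r * m powr (r - 1)"
  have "c * (m powr r + ?k * (u - m)) + (1 - c) * (m powr r + ?k * (1 - m))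
      \<le> c * u powr r + (1 - c) * 1 powr r"
    using assms \<open>0 < m\<close> by (intro add_mono mult_left_mono powr_ge_tangent) auto
  moreover have "c * (m powr r + ?k * (u - m)) + (1 - c) * (m powr r + ?k * (1 - m))
      = m powr r + ?k * (c * u + (1 - c) - m)"
    by (simp add: algebra_simps)
  ultimately show ?thesis
    by (simp add: m_def)
qed

text \<open>\<open>\<bar>x\<bar> + d\<close> is \<open>C + d\<close> times a convex combination of \<open>\<bar>x\<bar> / C\<close> and \<open>1\<close>.\<close>
lemma sum_powr_perturb_le:
  fixes w x y :: "'a \<Rightarrow> real"
  assumes "1 \<le> r" "0 < C" "0 < d"
    and w: "\<And>i. i \<in> I \<Longrightarrow> 0 \<le> w i" "sum w I \<le> 1"
    and close: "\<And>i. i \<in> I \<Longrightarrow> \<bar>y i - x i\<bar> \<le> d"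
    and x: "(\<Sum>i\<in>I. w i * \<bar>x i\<bar> powr r) \<le> C powr r"
  shows "(\<Sum>i\<in>I. w i * \<bar>y i\<bar> powr r) \<le> (C + d) powr r"
proof -
  define c where "c = C / (C + d)"
  have c: "0 \<le> c" "c < 1" and c': "1 - c = d / (C + d)"
    using assms by (simp_all add: c_def field_simps)
  have le: "\<bar>y i\<bar> powr r \<le> (C + d) powr r * (c * (\<bar>x i\<bar> powr r / C powr r) + (1 - c))"
    if "i \<in> I" for i
  proof -
    have "\<bar>y i\<bar> powr r \<le> (\<bar>x i\<bar> + d) powr r"
      using close[OF that] assms(1) by (intro powr_mono2) auto
    also have "\<bar>x i\<bar> + d = (C + d) * (c * (\<bar>x i\<bar> / C) + (1 - c))"
    proof -
      have "c * (\<bar>x i\<bar> / C) = \<bar>x i\<bar> / (C + d)"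
        using assms by (simp add: c_def)
      then show ?thesis
        unfolding c' using assms by (simp flip: add_divide_distrib)
    qed
    also have "\<dots> powr r = (C + d) powr r * (c * (\<bar>x i\<bar> / C) + (1 - c)) powr r"
      by (rule powr_mult)
    also have "\<dots> \<le> (C + d) powr r * (c * (\<bar>x i\<bar> / C) powr r + (1 - c))"
      using c assms by (intro mult_left_mono powr_convex_combination) auto
    also have "(\<bar>x i\<bar> / C) powr r = \<bar>x i\<bar> powr r / C powr r"
      using assms by (simp add: powr_divide)
    finally show ?thesis .
  qed
  \<comment> \<open>After summation the factor beside \<open>(C + d) powr r\<close> is at most
    \<open>c + (1 - c) = 1\<close>, by the bound on \<open>x\<close> and by
    \<open>sum w I \<le> 1\<close>. This is Minkowski's inequality for a perturbation bounded by the
    constant \<open>d\<close>.\<close>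
  have "(\<Sum>i\<in>I. w i * \<bar>y i\<bar> powr r)
      \<le> (\<Sum>i\<in>I. w i * ((C + d) powr r * (c * (\<bar>x i\<bar> powr r / C powr r) + (1 - c))))"
    using w le by (intro sum_mono mult_left_mono) auto
  also have "\<dots> = (C + d) powr r *
      (c * ((\<Sum>i\<in>I. w i * \<bar>x i\<bar> powr r) / C powr r) + (1 - c) * sum w I)"
    by (simp add: sum_distrib_left sum_divide_distrib sum.distrib[symmetric] algebra_simps)
  also have "\<dots> \<le> (C + d) powr r * (c * 1 + (1 - c) * 1)"
    using x w c assms by (intro mult_left_mono add_mono) auto
  finally show ?thesis
    by simp
qed

text \<open>The tangent inequality is applied to \<open>\<bar>f x\<bar>\<close> at the point
  \<open>m\<close>, the absolute value of the average of \<open>f\<close> on \<open>E\<close>, and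
  integrated over \<open>E\<close>. The linear term contributes a nonnegative amount, because
  \<open>m\<close> is at most the average of \<open>\<bar>f\<bar>\<close>.\<close>

lemma (in finite_measure) jensen_set_powr:
  fixes f :: "'a \<Rightarrow> real"
  assumes "1 \<le> r" "E \<in> sets M" "0 < measure M E"
    and f: "integrable M f"
    and fr: "integrable M (\<lambda>x. \<bar>f x\<bar> powr r)"
  shows "measure M E * \<bar>(LINT x:E|M. f x) / measure M E\<bar> powr r \<le> (LINT x:E|M. \<bar>f x\<bar> powr r)"
proof -
  define \<mu> where "\<mu> = measure M E"
  define m where "m = \<bar>(LINT x:E|M. f x) / \<mu>\<bar>"
  note f' [simp] = integrable_mult_indicator[OF \<open>E \<in> sets M\<close> f, simplified]
    integrable_mult_indicator[OF \<open>E \<in> sets M\<close> integrable_abs[OF f], simplified]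
    integrable_mult_indicator[OF \<open>E \<in> sets M\<close> fr, simplified]
  have E [simp]: "integrable M (indicat_real E)" "measure M (E \<inter> space M) = \<mu>"
    using \<open>E \<in> sets M\<close> by (auto simp: \<mu>_def emeasure_finite less_top[symmetric])
  have nonneg: "0 \<le> (LINT x:E|M. \<bar>f x\<bar> powr r)"
    by (auto simp: set_lebesgue_integral_def intro!: integral_nonneg_AE)
  \<comment> \<open>The tangent point must be positive; for \<open>m = 0\<close> the left side is 0
    since \<open>0 powr r = 0\<close>.\<close>
  show ?thesis
  proof (cases "m = 0")
    case True
    then show ?thesis
      unfolding \<mu>_def[symmetric] m_def[symmetric] using nonneg by simp
  next
    case False
    then have "0 < m"
      by (simp add: m_def)
    let ?k = "r * m powr (r - 1)"
    have abs_le: "m * \<mu> \<le> (LINT x|M. indicat_real E x * \<bar>f x\<bar>)"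
    proof -
      have "\<bar>LINT x|M. indicat_real E x * f x\<bar> \<le> (LINT x|M. \<bar>indicat_real E x * f x\<bar>)"
        by (rule integral_abs_bound)
      then show ?thesis
        using assms(3) by (simp add: m_def \<mu>_def set_lebesgue_integral_def abs_mult)
    qed
    have "m powr r * \<mu> \<le> m powr r * \<mu> + ?k * ((LINT x|M. indicat_real E x * \<bar>f x\<bar>) - m * \<mu>)"
      using abs_le \<open>1 \<le> r\<close> by simp
    also have "\<dots> = (LINT x|M. m powr r * indicat_real E x
        + ?k * (indicat_real E x * \<bar>f x\<bar> - m * indicat_real E x))"
      by simp
    \<comment> \<open>Pointwise this is the tangent inequality on \<open>E\<close>, while both sides
      vanish off \<open>E\<close>.\<close>
    also have "\<dots> \<le> (LINT x|M. indicat_real E x * \<bar>f x\<bar> powr r)"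
      using powr_ge_tangent[OF \<open>1 \<le> r\<close> _ \<open>0 < m\<close>]
      by (intro integral_mono) (simp_all, simp add: indicator_def)
    finally show ?thesis
      by (simp add: set_lebesgue_integral_def m_def \<mu>_def mult.commute)
  qed
qed

section \<open>The unit square\<close>

lemma in_sets_unit_interval_iff: "S \<in> sets unit_interval \<longleftrightarrow> S \<in> sets borel \<and> S \<subseteq> {0..1}"
  by (auto simp: unit_interval_def sets_restrict_space_iff)

lemma space_unit_interval [simp]: "space unit_interval = {0..1}"
  by (simp add: unit_interval_def space_restrict_space)

lemma space_unit_square [simp]: "space unit_square = {0..1} \<times> {0..1}"
  by (simp add: unit_square_def space_restrict_space)

lemma borel_Times: "S \<in> sets borel \<Longrightarrow> T \<in> sets borel \<Longrightarrow> S \<times> T \<in> sets (borel :: (real \<times> real) measure)"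
  by (metis borel_prod pair_measureI)

lemma emeasure_lborel_Times:
  fixes S T :: "real set"
  assumes "S \<in> sets borel" "T \<in> sets borel"
  shows "emeasure lborel (S \<times> T) = emeasure lborel S * emeasure lborel T"
  using assms by (simp add: lborel_prod[symmetric] lborel.emeasure_pair_measure_Times)

lemma Times_in_sets_unit_square:
  assumes "S \<in> sets unit_interval" "T \<in> sets unit_interval"
  shows "S \<times> T \<in> sets unit_square"
  using assms borel_Times
  by (auto simp: unit_square_def in_sets_unit_interval_iff sets_restrict_space_iff)

lemma emeasure_unit_interval:
  "S \<in> sets unit_interval \<Longrightarrow> emeasure unit_interval S = emeasure lborel S"
  by (simp add: in_sets_unit_interval_iff) (simp add: unit_interval_def emeasure_restrict_space)

lemma emeasure_unit_square_Times:
  assumes "S \<in> sets unit_interval" "T \<in> sets unit_interval"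
  shows "emeasure unit_square (S \<times> T) = emeasure unit_interval S * emeasure unit_interval T"
proof -
  have "S \<times> T \<subseteq> {0..1} \<times> {0..1}"
    using assms by (auto simp: in_sets_unit_interval_iff)
  then have "emeasure unit_square (S \<times> T) = emeasure lborel (S \<times> T)"
    using borel_Times[of "{0..1}" "{0..1}"]
    by (simp add: unit_square_def emeasure_restrict_space)
  then show ?thesis
    using assms by (simp add: emeasure_unit_interval emeasure_lborel_Times in_sets_unit_interval_iff)
qed

lemma measure_unit_square_Times:
  assumes "S \<in> sets unit_interval" "T \<in> sets unit_interval"
  shows "measure unit_square (S \<times> T) = measure unit_interval S * measure unit_interval T"
  using assms by (simp add: measure_def emeasure_unit_square_Times enn2real_mult)

interpretation unit_interval: prob_space unit_interval
  by (rule prob_spaceI) (simp add: emeasure_unit_interval in_sets_unit_interval_iff)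

interpretation unit_square: prob_space unit_square
  by (rule prob_spaceI)
    (simp add: emeasure_unit_square_Times in_sets_unit_interval_iff emeasure_unit_interval)

section \<open>The cut norm, and integrals of step functions over rectangles\<close>

text \<open>A real supremum dominates its members only if the set is bounded above. Integrability of
  \<open>U\<close> ensures this: the integral of \<open>\<bar>U\<bar>\<close> over the whole square
  bounds every rectangle integral.\<close>

lemma abs_set_integral_le_cut_norm:
  assumes U: "integrable unit_square (\<lambda>(x, y). U x y)"
    and ST: "S \<in> sets unit_interval" "T \<in> sets unit_interval"
  shows "\<bar>LINT (x, y):S \<times> T|unit_square. U x y\<bar> \<le> cut_norm U"
  unfolding cut_norm_def
proof (rule cSUP_upper2[of _ _ "(S, T)"])
  show "bdd_above ((\<lambda>(S, T). \<bar>LINT (x, y):S \<times> T|unit_square. U x y\<bar>) `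
      (sets unit_interval \<times> sets unit_interval))"
  proof (rule bdd_aboveI2[where M = "LINT z|unit_square. \<bar>case z of (x, y) \<Rightarrow> U x y\<bar>"], clarify)
    fix A B assume "A \<in> sets unit_interval" "B \<in> sets unit_interval"
    then have AB: "A \<times> B \<in> sets unit_square"
      by (rule Times_in_sets_unit_square)
    have "\<bar>LINT (x, y):A \<times> B|unit_square. U x y\<bar>
        \<le> (LINT z|unit_square. \<bar>indicat_real (A \<times> B) z *\<^sub>R (case z of (x, y) \<Rightarrow> U x y)\<bar>)"
      unfolding set_lebesgue_integral_def by (rule integral_abs_bound)
    also have "\<dots> \<le> (LINT z|unit_square. \<bar>case z of (x, y) \<Rightarrow> U x y\<bar>)"
      using U integrable_mult_indicator[OF AB U]
      by (intro integral_mono) (auto simp: indicator_def)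
    finally show "\<bar>LINT (x, y):A \<times> B|unit_square. U x y\<bar>
        \<le> (LINT z|unit_square. \<bar>case z of (x, y) \<Rightarrow> U x y\<bar>)" .
  qed
qed (use ST in auto)

lemma step_function_integrable:
  assumes "\<And>i. i \<in> V \<Longrightarrow> J i \<in> sets unit_interval"
  shows "integrable unit_square
    (\<lambda>(x, y). \<Sum>i\<in>V. \<Sum>j\<in>V. e i j * indicat_real (J i) x * indicat_real (J j) y)"
proof -
  have "integrable unit_square (\<lambda>z. \<Sum>i\<in>V. \<Sum>j\<in>V. e i j * indicat_real (J i \<times> J j) z)"
    using assms Times_in_sets_unit_square
    by (intro Bochner_Integration.integrable_sum integrable_mult_right)
      (auto simp: unit_square.emeasure_finite less_top[symmetric])
  then show ?thesis
    by (simp add: case_prod_unfold indicator_times mult.assoc)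
qed

text \<open>Restricting the step function to a union of its own cells just selects the corresponding
  terms, so the integral is a finite sum of values times cell areas.\<close>

lemma step_function_integral:
  fixes e :: "'i \<Rightarrow> 'i \<Rightarrow> real"
  assumes V: "finite V" "A \<subseteq> V" "B \<subseteq> V"
    and J: "\<And>i. i \<in> V \<Longrightarrow> J i \<in> sets unit_interval" "disjoint_family_on J V"
  shows "(LINT (x, y):(\<Union>i\<in>A. J i) \<times> (\<Union>j\<in>B. J j)|unit_square.
      (\<Sum>i\<in>V. \<Sum>j\<in>V. e i j * indicat_real (J i) x * indicat_real (J j) y))
    = (\<Sum>i\<in>A. \<Sum>j\<in>B. e i j * (measure unit_interval (J i) * measure unit_interval (J j)))"
proof -
  have uniq: "k = i" if "i \<in> V" "k \<in> V" "x \<in> J i" "x \<in> J k" for i k x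
    using J(2) that unfolding disjoint_family_on_def by blast
  \<comment> \<open>Disjointness enters here: a cell \<open>J i\<close> with \<open>i\<close>
    outside \<open>U\<close> misses the whole union over \<open>U\<close>, so its term
    vanishes.\<close>
  have restrict: "indicat_real (\<Union>i\<in>U. J i) x * indicat_real (J i) x
      = (if i \<in> U then indicat_real (J i) x else 0)"
    if "U \<subseteq> V" "i \<in> V" for U i x
    using that uniq[OF that(2)] by (auto simp: indicator_def subset_iff)
  have sum_restrict: "(\<Sum>i\<in>V. if i \<in> U then f i else 0) = sum f U" if "U \<subseteq> V" for U f
    using that V(1) by (simp add: sum.If_cases Int_absorb1)
  have "indicat_real ((\<Union>i\<in>A. J i) \<times> (\<Union>j\<in>B. J j)) (x, y) *
        (\<Sum>i\<in>V. \<Sum>j\<in>V. e i j * indicat_real (J i) x * indicat_real (J j) y)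
      = (\<Sum>i\<in>A. \<Sum>j\<in>B. e i j * indicat_real (J i \<times> J j) (x, y))" for x y
  proof -
    have "indicat_real ((\<Union>i\<in>A. J i) \<times> (\<Union>j\<in>B. J j)) (x, y) *
        (\<Sum>i\<in>V. \<Sum>j\<in>V. e i j * indicat_real (J i) x * indicat_real (J j) y)
      = (\<Sum>i\<in>V. \<Sum>j\<in>V. e i j * (indicat_real (\<Union>i\<in>A. J i) x * indicat_real (J i) x)
          * (indicat_real (\<Union>i\<in>B. J i) y * indicat_real (J j) y))"
      unfolding indicator_times sum_distrib_left by (simp add: mult_ac)
    also have "\<dots> = (\<Sum>i\<in>V. if i \<in> A then \<Sum>j\<in>V. if j \<in> B then
        e i j * indicat_real (J i) x * indicat_real (J j) y else 0 else 0)"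
      using V by (intro sum.cong refl) (auto simp: restrict intro!: sum.cong)
    also have "\<dots> = (\<Sum>i\<in>A. \<Sum>j\<in>B. e i j * indicat_real (J i \<times> J j) (x, y))"
      using V by (simp add: sum_restrict indicator_times mult.assoc)
    finally show ?thesis .
  qed
  then have "(LINT (x, y):(\<Union>i\<in>A. J i) \<times> (\<Union>j\<in>B. J j)|unit_square.
      (\<Sum>i\<in>V. \<Sum>j\<in>V. e i j * indicat_real (J i) x * indicat_real (J j) y))
    = (LINT z|unit_square. (\<Sum>i\<in>A. \<Sum>j\<in>B. e i j * indicat_real (J i \<times> J j) z))"
    by (auto simp: set_lebesgue_integral_def intro!: Bochner_Integration.integral_cong)
  also have "\<dots> = (\<Sum>i\<in>A. \<Sum>j\<in>B. e i j * (LINT z|unit_square. indicat_real (J i \<times> J j) z))"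
    using V J Times_in_sets_unit_square
    by (subst Bochner_Integration.integral_sum;
        (intro Bochner_Integration.integrable_sum sum.cong refl
          Bochner_Integration.integral_sum[THEN trans])?)
      (auto simp: unit_square.emeasure_finite less_top[symmetric] subset_iff)
  also have "\<dots> = (\<Sum>i\<in>A. \<Sum>j\<in>B. e i j * (measure unit_interval (J i) * measure unit_interval (J j)))"
  proof (intro sum.cong refl)
    fix i j assume "i \<in> A" "j \<in> B"
    then have ij: "J i \<in> sets unit_interval" "J j \<in> sets unit_interval"
      using V J by auto
    \<comment> \<open>The integral of an indicator simplifies to the measure of the set intersected
      with the space, which here is the rectangle itself.\<close>
    then have "(J i \<times> J j) \<inter> ({0..1} \<times> {0..1}) = J i \<times> J j"
      by (auto simp: in_sets_unit_interval_iff)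
    then show "e i j * (LINT z|unit_square. indicat_real (J i \<times> J j) z)
        = e i j * (measure unit_interval (J i) * measure unit_interval (J j))"
      using ij by (simp add: measure_unit_square_Times)
  qed
  finally show ?thesis .
qed

section \<open>Node intervals\<close>

lemma set_weight_mono:
  assumes "weighted_graph G" "A \<subseteq> B" "B \<subseteq> verts G"
  shows "set_weight G A \<le> set_weight G B"
  unfolding set_weight_def using assms
  by (intro sum_mono2) (auto simp: weighted_graph_def finite_subset less_imp_le subset_iff)

text \<open>The end points are partial sums of relative weights in the vertex order. Hence
  \<open>b i - a i\<close> is the relative weight of \<open>i\<close>, and
  \<open>b i \<le> a j\<close> whenever \<open>i < j\<close>; all three claims follow from these two
  facts.\<close>

lemma node_interval:
  fixes G :: "('v::linorder) wgraph"
  assumes G: "weighted_graph G" and pos: "0 < total_weight G"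
  shows node_interval_sets: "i \<in> verts G \<Longrightarrow> node_interval G i \<in> sets unit_interval"
    and measure_node_interval:
      "i \<in> verts G \<Longrightarrow> measure unit_interval (node_interval G i) = vweight G i / total_weight G"
    and node_interval_disjoint: "disjoint_family_on (node_interval G) (verts G)"
proof -
  define a where "a i = set_weight G {j \<in> verts G. j < i} / total_weight G" for i
  define b where "b i = set_weight G {j \<in> verts G. j \<le> i} / total_weight G" for i
  have fin: "finite (verts G)"
    using G by (simp add: weighted_graph_def)
  have N: "node_interval G i = (if i = Max (verts G) then {a i..b i} else {a i..<b i})" for i
    by (simp add: node_interval_def a_def b_def)
  have b: "b i = a i + vweight G i / total_weight G" if "i \<in> verts G" for i
  proof -
    have "{j \<in> verts G. j \<le> i} = insert i {j \<in> verts G. j < i}"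
      using that by auto
    then show ?thesis
      using fin by (simp add: a_def b_def set_weight_def add_divide_distrib)
  qed
  have a0: "0 \<le> a i" for i
    using set_weight_mono[OF G, of "{}" "{j \<in> verts G. j < i}"] pos
    by (auto simp: a_def set_weight_def)
  have b1: "b i \<le> 1" for i
    using set_weight_mono[OF G, of "{j \<in> verts G. j \<le> i}" "verts G"] pos
    by (auto simp: b_def total_weight_def)
  have ba: "b i \<le> a j" if "i < j" for i j
    unfolding a_def b_def using pos that
    by (intro divide_right_mono set_weight_mono[OF G]) auto
  show sets: "node_interval G i \<in> sets unit_interval" if "i \<in> verts G" for i
    using a0[of i] b1[of i] by (auto simp: N in_sets_unit_interval_iff)
  show "measure unit_interval (node_interval G i) = vweight G i / total_weight G"
    if "i \<in> verts G" for i
  proof -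
    have "0 \<le> vweight G i / total_weight G"
      using G that pos by (auto simp: weighted_graph_def less_imp_le)
    then have "measure lborel (node_interval G i) = vweight G i / total_weight G"
      using b[OF that] by (cases "i = Max (verts G)") (simp_all only: N if_True if_False, simp_all)
    then show ?thesis
      using sets[OF that] by (simp add: measure_def emeasure_unit_interval)
  qed
  have "node_interval G i \<inter> node_interval G j = {}" if "i \<in> verts G" "j \<in> verts G" "i < j" for i j
  proof -
    \<comment> \<open>Only the last interval contains its right end. The smaller vertex is not the
      last one, so its interval stops short of \<open>b i \<le> a j\<close>.\<close>
    have "i \<noteq> Max (verts G)"
      using that Max_ge[OF fin, of j] by auto
    then show ?thesis
      using ba[OF that(3)] by (auto simp: N split: if_splits)
  qed
  then show "disjoint_family_on (node_interval G) (verts G)"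
    unfolding disjoint_family_on_def by (metis Int_commute linorder_neqE)
qed

section \<open>Rescaled graphs, and the blocks obtained from a small cut distance\<close>

text \<open>The last rule speaks of a separate graph \<open>H\<close>, since node intervals require
  linearly ordered vertices while the other rules hold over any vertex type.\<close>

lemma scale_graph_simps [simp]:
  "verts (scale_graph c G) = verts G"
  "vweight (scale_graph c G) = vweight G"
  "eweight (scale_graph c G) i j = c * eweight G i j"
  "set_weight (scale_graph c G) U = set_weight G U"
  "total_weight (scale_graph c G) = total_weight G"
  "node_interval (scale_graph c H) k = node_interval H k"
  by (auto simp: scale_graph_def set_weight_def total_weight_def node_interval_def)

lemma weighted_graph_scale_graph: "weighted_graph G \<Longrightarrow> weighted_graph (scale_graph c G)"
  by (auto simp: weighted_graph_def) (auto simp: scale_graph_def)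

text \<open>A nonzero norm rules out the empty vertex set, and every vertex weight is
  positive.\<close>

lemma total_weight_pos:
  assumes "weighted_graph G" "graph_norm1 G \<noteq> 0"
  shows "0 < total_weight G"
proof -
  have "verts G \<noteq> {}"
    using assms(2) by (auto simp: graph_norm1_def)
  then show ?thesis
    using assms(1) by (auto simp: weighted_graph_def total_weight_def set_weight_def intro!: sum_pos)
qed

lemma graph_norm1_nonneg:
  assumes "weighted_graph G"
  shows "0 \<le> graph_norm1 G"
  using assms by (auto simp: graph_norm1_def weighted_graph_def less_imp_le intro!: sum_nonneg)

text \<open>Replaces the cut distance by concrete cells: \<open>J i\<close> is the preimage of the
  node interval of \<open>i\<close> under a nearly optimal rearrangement. The cut norm controls all
  rectangles at once, so one family \<open>J\<close> serves every pair \<open>A\<close>,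
  \<open>B\<close>.\<close>

lemma graph_cut_dist_less_obtains:
  fixes G :: "('v::linorder) wgraph"
  assumes G: "weighted_graph G" and pos: "0 < total_weight G"
    and W: "graphon W"
    and dist: "graph_cut_dist G W < \<epsilon>"
  obtains J where "\<And>i. i \<in> verts G \<Longrightarrow> J i \<in> sets unit_interval"
    and "\<And>i. i \<in> verts G \<Longrightarrow> measure unit_interval (J i) = vweight G i / total_weight G"
    and "disjoint_family_on J (verts G)"
    and "\<And>A B. A \<subseteq> verts G \<Longrightarrow> B \<subseteq> verts G \<Longrightarrow>
      \<bar>(\<Sum>i\<in>A. \<Sum>j\<in>B. eweight G i j * (vweight G i / total_weight G * (vweight G j / total_weight G)))
        - (LINT (x, y):(\<Union>i\<in>A. J i) \<times> (\<Union>j\<in>B. J j)|unit_square. W x y)\<bar> < \<epsilon>"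
proof -
  \<comment> \<open>The identity makes the set under the infimum nonempty, so an infimum below
    \<open>\<epsilon>\<close> yields a member below \<open>\<epsilon>\<close>.\<close>
  have "measure_preserving_bij (\<lambda>x. x)"
    by (simp add: measure_preserving_bij_def bij_betw_def)
  then have nonempty: "(\<lambda>\<sigma>. cut_norm (\<lambda>x y. rearrange \<sigma> (graphon_of G) x y - W x y)) `
      {\<sigma>. measure_preserving_bij \<sigma>} \<noteq> {}"
    by blast
  obtain \<sigma> where \<sigma>: "measure_preserving_bij \<sigma>"
    and cut: "cut_norm (\<lambda>x y. rearrange \<sigma> (graphon_of G) x y - W x y) < \<epsilon>"
    using cInf_lessD[OF nonempty dist[unfolded graph_cut_dist_def cut_dist_def]] by blast
  have \<sigma>_meas: "\<sigma> \<in> measurable unit_interval unit_interval"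
    and \<sigma>_distr: "distr unit_interval unit_interval \<sigma> = unit_interval"
    using \<sigma> by (auto simp: measure_preserving_bij_def)
  define J where "J i = \<sigma> -` node_interval G i \<inter> {0..1}" for i
  have J_sets: "J i \<in> sets unit_interval" if "i \<in> verts G" for i
    using measurable_sets[OF \<sigma>_meas node_interval_sets[OF G pos that]] by (simp add: J_def)
  have J_measure: "measure unit_interval (J i) = vweight G i / total_weight G"
    if "i \<in> verts G" for i
    using measure_distr[OF \<sigma>_meas node_interval_sets[OF G pos that]]
      measure_node_interval[OF G pos that] by (simp add: \<sigma>_distr J_def)
  have J_disj: "disjoint_family_on J (verts G)"
    using node_interval_disjoint[OF G pos] by (auto simp: disjoint_family_on_def J_def)
  let ?H = "\<lambda>x y. \<Sum>i\<in>verts G. \<Sum>j\<in>verts G.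
    eweight G i j * indicat_real (J i) x * indicat_real (J j) y"
  \<comment> \<open>The rearranged graphon is the step function with cells \<open>J i\<close>. The
    equality is claimed only on the unit square, because the cells are cut to \<open>[0,1]\<close>
    while \<open>\<sigma>\<close> is arbitrary outside it.\<close>
  have H: "rearrange \<sigma> (graphon_of G) x y = ?H x y" if "x \<in> {0..1}" "y \<in> {0..1}" for x y
    unfolding rearrange_def graphon_of_def using that
    by (intro sum.cong refl) (auto simp: J_def indicator_def)
  have H_int: "integrable unit_square (\<lambda>(x, y). ?H x y)"
    using J_sets by (rule step_function_integrable)
  have W_int: "integrable unit_square (\<lambda>(x, y). W x y)"
    using W by (simp add: graphon_def)
  have diff_int: "integrable unit_square (\<lambda>(x, y). rearrange \<sigma> (graphon_of G) x y - W x y)"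
  proof -
    have "integrable unit_square (\<lambda>z. (case z of (x, y) \<Rightarrow> ?H x y) - (case z of (x, y) \<Rightarrow> W x y))"
      using H_int W_int by (rule Bochner_Integration.integrable_diff)
    then show ?thesis
      by (rule Bochner_Integration.integrable_cong[THEN iffD1, rotated 2]) (auto simp: H)
  qed
  have "\<bar>(\<Sum>i\<in>A. \<Sum>j\<in>B. eweight G i j * (vweight G i / total_weight G * (vweight G j / total_weight G)))
        - (LINT (x, y):(\<Union>i\<in>A. J i) \<times> (\<Union>j\<in>B. J j)|unit_square. W x y)\<bar> < \<epsilon>"
    if AB: "A \<subseteq> verts G" "B \<subseteq> verts G" for A B
  proof -
    let ?S = "\<Union>i\<in>A. J i" and ?T = "\<Union>j\<in>B. J j"
    have fin: "finite (verts G)"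
      using G by (simp add: weighted_graph_def)
    have ST: "?S \<in> sets unit_interval" "?T \<in> sets unit_interval"
      using AB fin J_sets by (auto intro!: sets.finite_UN dest: finite_subset)
    have "set_integrable unit_square (?S \<times> ?T) (\<lambda>(x, y). ?H x y)"
      "set_integrable unit_square (?S \<times> ?T) (\<lambda>(x, y). W x y)"
      unfolding set_integrable_def
      using integrable_mult_indicator[OF Times_in_sets_unit_square[OF ST]] H_int W_int by blast+
    then have "(LINT (x, y):?S \<times> ?T|unit_square. ?H x y) - (LINT (x, y):?S \<times> ?T|unit_square. W x y)
        = (LINT z:?S \<times> ?T|unit_square. (case z of (x, y) \<Rightarrow> ?H x y) - (case z of (x, y) \<Rightarrow> W x y))"
      by (rule set_integral_diff(2)[symmetric])
    also have "\<dots> = (LINT (x, y):?S \<times> ?T|unit_square. rearrange \<sigma> (graphon_of G) x y - W x y)"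
      unfolding set_lebesgue_integral_def
      by (intro Bochner_Integration.integral_cong refl) (auto simp: H)
    also have "\<bar>\<dots>\<bar> < \<epsilon>"
      using abs_set_integral_le_cut_norm[OF diff_int ST] cut by simp
    also have "(LINT (x, y):?S \<times> ?T|unit_square. ?H x y)
        = (\<Sum>i\<in>A. \<Sum>j\<in>B. eweight G i j * (vweight G i / total_weight G * (vweight G j / total_weight G)))"
      using AB by (subst step_function_integral[OF fin AB J_sets J_disj])
        (auto simp: J_measure subset_iff intro!: sum.cong)
    finally show ?thesis .
  qed
  with J_sets J_measure J_disj show thesis
    by (rule that)
qed

text \<open>Each part has relative weight at least \<open>\<eta>\<close>, so each block
  \<open>E (A, B)\<close> has measure at least \<open>\<eta>\<^sup>2\<close>. Dividing an integral
  error below \<open>\<eta>\<^sup>2 * d\<close> by that measure leaves at most \<open>d\<close>,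
  which explains the threshold. Blocks are indexed by pairs so that they form one disjoint family in
  the square.\<close>

lemma partition_rectangles:
  fixes G :: "('v::linorder) wgraph"
  assumes G: "weighted_graph G" and norm: "graph_norm1 G \<noteq> 0"
    and W: "graphon W"
    and dist: "graph_cut_dist (scale_graph (1 / graph_norm1 G) G) W < \<eta>\<^sup>2 * d"
    and "0 < \<eta>" "0 < d"
    and P: "partition_on (verts G) P"
    and big: "\<And>A. A \<in> P \<Longrightarrow> \<eta> * total_weight G \<le> set_weight G A"
  obtains E where "\<And>A B. A \<in> P \<Longrightarrow> B \<in> P \<Longrightarrow> E (A, B) \<in> sets unit_square"
    and "disjoint_family_on E (P \<times> P)"
    and "\<And>A B. A \<in> P \<Longrightarrow> B \<in> P \<Longrightarrow>
      measure unit_square (E (A, B)) = set_weight G A * set_weight G B / (total_weight G)\<^sup>2"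
    and "\<And>A B. A \<in> P \<Longrightarrow> B \<in> P \<Longrightarrow> 0 < measure unit_square (E (A, B))"
    and "\<And>A B. A \<in> P \<Longrightarrow> B \<in> P \<Longrightarrow>
      \<bar>density G A B / graph_norm1 G
        - (LINT (x, y):E (A, B)|unit_square. W x y) / measure unit_square (E (A, B))\<bar> \<le> d"
proof -
  let ?t = "total_weight G" and ?V = "verts G"
  have t: "0 < ?t"
    by (rule total_weight_pos[OF G norm])
  have fin: "finite ?V"
    using G by (simp add: weighted_graph_def)
  have sub: "A \<subseteq> ?V" if "A \<in> P" for A
    using P that by (auto dest: partition_onD1)
  have finA: "finite A" if "A \<in> P" for A
    using sub[OF that] fin by (rule finite_subset)
  obtain J where J: "\<And>i. i \<in> ?V \<Longrightarrow> J i \<in> sets unit_interval"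
    and J_measure: "\<And>i. i \<in> ?V \<Longrightarrow> measure unit_interval (J i) = vweight G i / ?t"
    and J_disj: "disjoint_family_on J ?V"
    and J_close: "\<And>A B. A \<subseteq> ?V \<Longrightarrow> B \<subseteq> ?V \<Longrightarrow>
      \<bar>(\<Sum>i\<in>A. \<Sum>j\<in>B. eweight G i j / graph_norm1 G * (vweight G i / ?t * (vweight G j / ?t)))
        - (LINT (x, y):(\<Union>i\<in>A. J i) \<times> (\<Union>j\<in>B. J j)|unit_square. W x y)\<bar> < \<eta>\<^sup>2 * d"
    using graph_cut_dist_less_obtains[OF weighted_graph_scale_graph[OF G] _ W dist] t by auto
  define S where "S A = (\<Union>i\<in>A. J i)" for A
  define E where "E = (\<lambda>(A, B). S A \<times> S B)"
  have S: "S A \<in> sets unit_interval" if "A \<in> P" for A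
    unfolding S_def using sub[OF that] J finA[OF that] by (intro sets.finite_UN) auto
  have S_measure: "measure unit_interval (S A) = set_weight G A / ?t" if "A \<in> P" for A
  proof -
    have "disjoint_family_on J A"
      using J_disj sub[OF that] by (rule disjoint_family_on_mono[rotated])
    then have "measure unit_interval (S A) = (\<Sum>i\<in>A. measure unit_interval (J i))"
      unfolding S_def using J sub[OF that] finA[OF that]
      by (intro unit_interval.finite_measure_finite_Union) auto
    also have "\<dots> = (\<Sum>i\<in>A. vweight G i / ?t)"
      using sub[OF that] by (intro sum.cong) (auto simp: J_measure)
    finally show ?thesis
      by (simp add: set_weight_def sum_divide_distrib)
  qed
  have S_disj: "S A \<inter> S B = {}" if "A \<in> P" "B \<in> P" "A \<noteq> B" for A B
  proof -
    have "A \<inter> B = {}"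
      using partition_onD2[OF P] that by (auto simp: disjoint_def)
    then have "J i \<inter> J j = {}" if "i \<in> A" "j \<in> B" for i j
      using J_disj that sub[OF \<open>A \<in> P\<close>] sub[OF \<open>B \<in> P\<close>] unfolding disjoint_family_on_def
      by (metis IntI empty_iff subsetD)
    then show ?thesis
      by (auto simp: S_def)
  qed
  have pos: "0 < set_weight G A" if "A \<in> P" for A
    using big[OF that] mult_pos_pos[OF \<open>0 < \<eta>\<close> t] by linarith
  have E_measure: "measure unit_square (E (A, B)) = set_weight G A * set_weight G B / ?t\<^sup>2"
    if "A \<in> P" "B \<in> P" for A B
    using that by (simp add: E_def measure_unit_square_Times S S_measure power2_eq_square)
  have E_ge: "\<eta>\<^sup>2 \<le> measure unit_square (E (A, B))" if "A \<in> P" "B \<in> P" for A B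
  proof -
    have "\<eta> \<le> set_weight G A / ?t" "\<eta> \<le> set_weight G B / ?t"
      using big that t by (auto simp: field_simps)
    then have "\<eta> * \<eta> \<le> set_weight G A / ?t * (set_weight G B / ?t)"
      using \<open>0 < \<eta>\<close> by (intro mult_mono) auto
    then show ?thesis
      using that by (simp add: E_measure power2_eq_square)
  qed
  have close: "\<bar>density G A B / graph_norm1 G
      - (LINT (x, y):E (A, B)|unit_square. W x y) / measure unit_square (E (A, B))\<bar> \<le> d"
    if "A \<in> P" "B \<in> P" for A B
  proof -
    let ?m = "measure unit_square (E (A, B))"
    let ?I = "LINT (x, y):E (A, B)|unit_square. W x y"
    have m: "0 < ?m"
      using E_ge[OF that] \<open>0 < \<eta>\<close> by (smt (verit) zero_less_power)
    \<comment> \<open>The block measure cancels the set weights in the denominator of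
      \<open>density\<close>, turning the density into the plain weighted sum that the cells
      \<open>J\<close> control.\<close>
    have "?m * (density G A B / graph_norm1 G)
        = (\<Sum>i\<in>A. \<Sum>j\<in>B. eweight G i j / graph_norm1 G * (vweight G i / ?t * (vweight G j / ?t)))"
      unfolding E_measure[OF that] density_def sum_divide_distrib sum_distrib_left
      using pos[OF that(1)] pos[OF that(2)]
      by (intro sum.cong refl) (simp add: power2_eq_square mult_ac)
    then have "\<bar>?m * (density G A B / graph_norm1 G) - ?I\<bar> < \<eta>\<^sup>2 * d"
      using J_close[OF sub[OF that(1)] sub[OF that(2)]] by (simp add: E_def S_def)
    also have "\<dots> \<le> ?m * d"
      using E_ge[OF that] \<open>0 < d\<close> by simp
    also have "?m * (density G A B / graph_norm1 G) - ?I
        = ?m * (density G A B / graph_norm1 G - ?I / ?m)"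
      using m by (simp add: right_diff_distrib)
    also have "\<bar>\<dots>\<bar> = ?m * \<bar>density G A B / graph_norm1 G - ?I / ?m\<bar>"
      using m by (simp add: abs_mult)
    finally show ?thesis
      using m by simp
  qed
  show thesis
  proof (rule that[of E])
    show "disjoint_family_on E (P \<times> P)"
    proof (clarsimp simp: disjoint_family_on_def E_def)
      fix A B A' B' assume "A \<in> P" "B \<in> P" "A' \<in> P" "B' \<in> P" "A = A' \<longrightarrow> B \<noteq> B'"
      then have "S A \<inter> S A' = {} \<or> S B \<inter> S B' = {}"
        using S_disj by blast
      then show "S A \<times> S B \<inter> S A' \<times> S B' = {}"
        by auto
    qed
    show "0 < measure unit_square (E (A, B))" if "A \<in> P" "B \<in> P" for A B
      using E_ge[OF that] \<open>0 < \<eta>\<close> by (smt (verit) zero_less_power)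
  qed (use E_measure close in \<open>auto simp: E_def intro: Times_in_sets_unit_square S\<close>)
qed

section \<open>Block averages of a graphon\<close>

text \<open>Indicators of disjoint sets add up to the indicator of their union, which is at most 1,
  and \<open>f\<close> is nonnegative.\<close>

lemma sum_set_integral_le:
  fixes f :: "'a \<Rightarrow> real"
  assumes "finite I" "disjoint_family_on E I" "\<And>i. i \<in> I \<Longrightarrow> E i \<in> sets M"
    and f: "integrable M f" "\<And>x. 0 \<le> f x"
  shows "(\<Sum>i\<in>I. (LINT x:E i|M. f x)) \<le> (LINT x|M. f x)"
proof -
  have int: "integrable M (\<lambda>x. indicat_real (E i) x * f x)" if "i \<in> I" for i
    using integrable_mult_indicator[OF assms(3)[OF that] f(1)] by simp
  have "(\<Sum>i\<in>I. (LINT x:E i|M. f x)) = (LINT x|M. (\<Sum>i\<in>I. indicat_real (E i) x * f x))"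
    using int by (simp add: set_lebesgue_integral_def Bochner_Integration.integral_sum)
  also have "\<dots> \<le> (LINT x|M. f x)"
  proof (intro integral_mono)
    fix x
    have "(\<Sum>i\<in>I. indicat_real (E i) x * f x) = indicat_real (\<Union>i\<in>I. E i) x * f x"
      by (simp add: indicator_UN_disjoint[OF assms(1,2)] sum_distrib_right)
    also have "\<dots> \<le> f x"
      using f(2) by (simp add: indicator_def)
    finally show "(\<Sum>i\<in>I. indicat_real (E i) x * f x) \<le> f x" .
  qed (use int f in auto)
  finally show ?thesis .
qed

text \<open>Passes from the extended norm to a real integral: a finite norm excludes the branch
  \<open>I = \<infinity>\<close>, and then the powers \<open>1 / r\<close> and \<open>r\<close>
  cancel.\<close>

lemma Lp_norm_finite_integral:
  assumes "1 \<le> p" "p \<noteq> \<infinity>" and W: "Lp_graphon p W"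
  defines "r \<equiv> enn2real p"
  shows "integrable unit_square (\<lambda>z. \<bar>case z of (x, y) \<Rightarrow> W x y\<bar> powr r)"
    and "(LINT z|unit_square. \<bar>case z of (x, y) \<Rightarrow> W x y\<bar> powr r) = enn2real (Lp_norm p W) powr r"
proof -
  let ?f = "\<lambda>z. \<bar>case z of (x, y) \<Rightarrow> W x y\<bar> powr r"
  define I where "I = (\<integral>\<^sup>+z. ennreal (?f z) \<partial>unit_square)"
  have r: "1 \<le> r"
    using assms(1,2) unfolding r_def by (cases p) auto
  have norm: "Lp_norm p W = (if I = \<infinity> then \<infinity> else ennreal (enn2real I powr (1 / r)))"
    using \<open>p \<noteq> \<infinity>\<close> by (simp add: Lp_norm_def I_def r_def Let_def case_prod_unfold)
  have fin: "I < \<infinity>"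
    using W unfolding Lp_graphon_def norm by (auto simp: less_top split: if_splits)
  have [measurable]: "(\<lambda>(x, y). W x y) \<in> borel_measurable unit_square"
    using W by (auto simp: Lp_graphon_def graphon_def)
  show int: "integrable unit_square ?f"
    using fin by (intro integrableI_nonneg) (auto simp: I_def)
  have "(LINT z|unit_square. ?f z) = enn2real I"
    unfolding I_def by (intro integral_eq_nn_integral) auto
  also have "\<dots> = enn2real (Lp_norm p W) powr r"
    using fin r by (simp add: norm powr_powr)
  finally show "(LINT z|unit_square. ?f z) = enn2real (Lp_norm p W) powr r" .
qed

text \<open>The counterpart of Jensen's inequality for \<open>p = \<infinity>\<close>: the essential
  bound holds almost everywhere on the block and therefore for its average.\<close>

lemma abs_block_average_le_Linf:
  assumes W: "Lp_graphon \<infinity> W"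
    and E: "E \<in> sets unit_square" "0 < measure unit_square E"
  shows "\<bar>(LINT (x, y):E|unit_square. W x y) / measure unit_square E\<bar> \<le> enn2real (Lp_norm \<infinity> W)"
proof -
  let ?C = "enn2real (Lp_norm \<infinity> W)" and ?f = "\<lambda>(x, y). W x y"
  have W_int: "integrable unit_square ?f" and fin: "Lp_norm \<infinity> W < \<infinity>"
    using W by (auto simp: Lp_graphon_def graphon_def)
  \<comment> \<open>Finiteness of the norm matters, since \<open>enn2real\<close> would send an
    infinite essential supremum to 0.\<close>
  have "AE z in unit_square. ennreal \<bar>?f z\<bar> \<le> ennreal ?C"
    using esssup_AE[of "\<lambda>(x, y). ennreal \<bar>W x y\<bar>" unit_square] fin
    by (simp add: Lp_norm_def case_prod_unfold)
  then have AE: "AE z in unit_square. \<bar>?f z\<bar> \<le> ?C"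
    by (simp add: ennreal_le_iff)
  have "\<bar>LINT (x, y):E|unit_square. W x y\<bar> \<le> (LINT z|unit_square. \<bar>indicat_real E z *\<^sub>R ?f z\<bar>)"
    unfolding set_lebesgue_integral_def by (rule integral_abs_bound)
  also have "\<dots> \<le> (LINT z|unit_square. ?C * indicat_real E z)"
  proof (rule integral_mono_AE)
    show "AE z in unit_square. \<bar>indicat_real E z *\<^sub>R ?f z\<bar> \<le> ?C * indicat_real E z"
      using AE by eventually_elim (auto simp: indicator_def)
  qed (use E W_int integrable_mult_indicator[OF E(1) W_int] in
      \<open>auto simp: unit_square.emeasure_finite less_top[symmetric]\<close>)
  also have "\<dots> = ?C * measure unit_square E"
    using E(1) sets.Int_space_eq2[OF E(1)] by simp
  finally show ?thesis
    using E(2) by (simp add: field_simps)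
qed

section \<open>Upper regularity of a single graph, then of the sequence\<close>

lemma upper_Lp_regularI:
  fixes G :: "('v::linorder) wgraph"
  assumes p: "1 \<le> p" and W: "Lp_graphon p W"
    and G: "weighted_graph G" and norm: "graph_norm1 G \<noteq> 0"
    and \<eta>: "0 < \<eta>"
    and dom: "\<And>i. i \<in> verts G \<Longrightarrow> vweight G i \<le> \<eta> * total_weight G"
    and dist: "graph_cut_dist (scale_graph (1 / graph_norm1 G) G) W < \<eta>\<^sup>2 * (\<eta> / 2)"
  shows "upper_Lp_regular p (enn2real (Lp_norm p W) + \<eta>) \<eta> G"
  unfolding upper_Lp_regular_def
proof (intro conjI ballI allI impI)
  fix P assume P: "partition_on (verts G) P \<and> (\<forall>A\<in>P. set_weight G A \<ge> \<eta> * total_weight G)"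
  let ?C = "enn2real (Lp_norm p W)" and ?t = "total_weight G"
  have W': "graphon W"
    using W by (simp add: Lp_graphon_def)
  have W_int: "integrable unit_square (\<lambda>(x, y). W x y)"
    using W' by (simp add: graphon_def)
  have fin: "finite P"
    using G P by (auto simp: weighted_graph_def intro: finite_elements)
  have t: "0 < ?t"
    by (rule total_weight_pos[OF G norm])
  \<comment> \<open>For \<open>p = \<infinity>\<close> a maximum over \<open>P \<times> P\<close> is
    taken, which has to range over a nonempty set.\<close>
  have ne: "P \<noteq> {}"
    using P t by (auto simp: partition_on_def total_weight_def set_weight_def)
  obtain E where E: "\<And>A B. A \<in> P \<Longrightarrow> B \<in> P \<Longrightarrow> E (A, B) \<in> sets unit_square"
    and E_disj: "disjoint_family_on E (P \<times> P)"
    and E_measure: "\<And>A B. A \<in> P \<Longrightarrow> B \<in> P \<Longrightarrow>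
      measure unit_square (E (A, B)) = set_weight G A * set_weight G B / ?t\<^sup>2"
    and E_pos: "\<And>A B. A \<in> P \<Longrightarrow> B \<in> P \<Longrightarrow> 0 < measure unit_square (E (A, B))"
    and close: "\<And>A B. A \<in> P \<Longrightarrow> B \<in> P \<Longrightarrow>
      \<bar>density G A B / graph_norm1 G
        - (LINT (x, y):E (A, B)|unit_square. W x y) / measure unit_square (E (A, B))\<bar> \<le> \<eta> / 2"
    using partition_rectangles[OF G norm W' dist \<eta>, of P] P \<eta> by auto
  show "if p = \<infinity>
      then (MAX (A, B)\<in>P \<times> P. \<bar>density G A B\<bar> / graph_norm1 G) \<le> ?C + \<eta>
      else (\<Sum>A\<in>P. \<Sum>B\<in>P. set_weight G A * set_weight G B / ?t\<^sup>2 *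
          \<bar>density G A B / graph_norm1 G\<bar> powr enn2real p) \<le> (?C + \<eta>) powr enn2real p"
  proof (cases "p = \<infinity>")
    case True
    have "\<bar>density G A B\<bar> / graph_norm1 G \<le> ?C + \<eta>" if "A \<in> P" "B \<in> P" for A B
    proof -
      have "\<bar>density G A B\<bar> / graph_norm1 G = \<bar>density G A B / graph_norm1 G\<bar>"
        using graph_norm1_nonneg[OF G] by (simp add: abs_divide)
      moreover have "\<bar>(LINT (x, y):E (A, B)|unit_square. W x y) / measure unit_square (E (A, B))\<bar> \<le> ?C"
        using W unfolding True by (rule abs_block_average_le_Linf) (use that E E_pos in auto)
      ultimately show ?thesis
        using close[OF that] \<eta> by linarith
    qed
    then show ?thesis
      using True fin ne by (auto simp: Max_le_iff)
  next
    case False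
    define r where "r = enn2real p"
    have r: "1 \<le> r"
      using p False unfolding r_def by (cases p) auto
    let ?w = "\<lambda>AB. measure unit_square (E AB)"
    let ?y = "\<lambda>(A, B). density G A B / graph_norm1 G"
    let ?x = "\<lambda>AB. (LINT (x, y):E AB|unit_square. W x y) / ?w AB"
    let ?f = "\<lambda>z. \<bar>case z of (x, y) \<Rightarrow> W x y\<bar> powr r"
    have f: "integrable unit_square ?f" "(LINT z|unit_square. ?f z) = ?C powr r"
      unfolding r_def using Lp_norm_finite_integral[OF p False W] by simp_all
    have fin2: "finite (P \<times> P)"
      using fin by simp
    have "(\<Sum>AB\<in>P \<times> P. ?w AB * \<bar>?x AB\<bar> powr r) \<le> (\<Sum>AB\<in>P \<times> P. (LINT z:E AB|unit_square. ?f z))"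
      using E E_pos W_int f(1) r by (intro sum_mono unit_square.jensen_set_powr) auto
    also have "\<dots> \<le> ?C powr r"
      using sum_set_integral_le[OF fin2 E_disj _ f(1)] E f(2) by auto
    \<comment> \<open>The perturbation lemma asks for a positive bound, whereas \<open>?C\<close> is
      only known to be nonnegative. One half of \<open>\<eta>\<close> makes the bound positive here;
      the other half absorbs the distance between densities and averages.\<close>
    also have "\<dots> \<le> (?C + \<eta> / 2) powr r"
      using r \<eta> by (intro powr_mono2) auto
    finally have x: "(\<Sum>AB\<in>P \<times> P. ?w AB * \<bar>?x AB\<bar> powr r) \<le> (?C + \<eta> / 2) powr r" .
    \<comment> \<open>Disjoint blocks in a probability space have total measure at most 1, so their
      measures can serve as weights in \<open>sum_powr_perturb_le\<close>.\<close>
    have "sum ?w (P \<times> P) = measure unit_square (\<Union>AB\<in>P \<times> P. E AB)"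
      using fin E E_disj by (intro unit_square.finite_measure_finite_Union[symmetric]) auto
    then have w: "sum ?w (P \<times> P) \<le> 1"
      by (simp add: unit_square.prob_le_1)
    have "(\<Sum>AB\<in>P \<times> P. ?w AB * \<bar>?y AB\<bar> powr r) \<le> (?C + \<eta> / 2 + \<eta> / 2) powr r"
    proof (rule sum_powr_perturb_le[OF r _ _ _ w _ x])
      show "0 < ?C + \<eta> / 2"
        using \<eta> by (simp add: add_nonneg_pos)
    qed (use \<eta> close in auto)
    also have "(\<Sum>AB\<in>P \<times> P. ?w AB * \<bar>?y AB\<bar> powr r) = (\<Sum>A\<in>P. \<Sum>B\<in>P.
        set_weight G A * set_weight G B / ?t\<^sup>2 * \<bar>density G A B / graph_norm1 G\<bar> powr r)"
      by (subst sum.cartesian_product) (intro sum.cong refl, auto simp: E_measure)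
    finally show ?thesis
      using False by (simp add: r_def add.commute)
  qed
qed (use dom in auto)

theorem corollary2p11:
  fixes p :: ennreal
    and W :: "real \<Rightarrow> real \<Rightarrow> real"
    and G :: "nat \<Rightarrow> ('v::linorder) wgraph"
  assumes "1 \<le> p"
    and "Lp_graphon p W"
    and "\<And>n. weighted_graph (G n)"
    and "\<And>n. graph_norm1 (G n) \<noteq> 0"
    and "no_dominant_nodes G"
    and "(\<lambda>n. graph_cut_dist (scale_graph (1 / graph_norm1 (G n)) (G n)) W) \<longlonglongrightarrow> 0"
  shows "upper_Lp_regular_seq p (enn2real (Lp_norm p W)) G"
  unfolding upper_Lp_regular_seq_def
proof (intro allI impI)
  fix \<eta> :: real assume \<eta>: "0 < \<eta>"
  \<comment> \<open>For fixed \<open>\<eta>\<close> the two limits provide, for all large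
    \<open>n\<close>, the distance bound and the bound on single vertices that
    \<open>upper_Lp_regularI\<close> requires.\<close>
  have "\<forall>\<^sub>F n in sequentially.
      graph_cut_dist (scale_graph (1 / graph_norm1 (G n)) (G n)) W < \<eta>\<^sup>2 * (\<eta> / 2)"
    using assms(6) \<eta> by (intro order_tendstoD(2)) auto
  moreover have "\<forall>\<^sub>F n in sequentially.
      (MAX i\<in>verts (G n). vweight (G n) i / total_weight (G n)) < \<eta>"
    using assms(5) \<eta> unfolding no_dominant_nodes_def by (rule order_tendstoD(2))
  ultimately have "\<forall>\<^sub>F n in sequentially. upper_Lp_regular p (enn2real (Lp_norm p W) + \<eta>) \<eta> (G n)"
  proof eventually_elim
    case (elim n)
    have "vweight (G n) i \<le> \<eta> * total_weight (G n)" if "i \<in> verts (G n)" for i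
    proof -
      have "vweight (G n) i / total_weight (G n)
          \<le> (MAX i\<in>verts (G n). vweight (G n) i / total_weight (G n))"
        using assms(3)[of n] that by (intro Max_ge) (auto simp: weighted_graph_def)
      also have "\<dots> < \<eta>"
        by (rule elim(2))
      finally show ?thesis
        using total_weight_pos[OF assms(3) assms(4), of n] by (simp add: field_simps)
    qed
    then show ?case
      using assms(1-4) \<eta> elim(1) by (intro upper_Lp_regularI) auto
  qed
  then show "\<exists>n0. \<forall>n\<ge>n0. upper_Lp_regular p (enn2real (Lp_norm p W) + \<eta>) \<eta> (G n)"
    by (simp add: eventually_sequentially)
qed

end
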